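(* Consider the control system $\dot{\boldsymbol{x}}=f(\boldsymbol{x})+g(\boldsymbol{x})\boldsymbol{u}$, with $\boldsymbol{x}\in\mathbb{R}^n$, $\boldsymbol{u}\in\mathcal{U}=\{\boldsymbol{u}\in\mathbb{R}^{p}:\boldsymbol{u}_{min}\le\boldsymbol{u}\le\boldsymbol{u}_{max}\}$ (componentwise), and $f,g$ locally Lipschitz. Let $h:\mathbb{R}^n\to\mathbb{R}$ be an Auxiliary-Variable Adaptive Control Lyapunov Barrier Function (AVCLBF) of relative degree $m\ge 2$ for this system (defined in the context), with extended class $\kappa$ function $\beta(h)=h^{q}$, $q\in(0,1)$, time-varying coefficient $c(t)$, auxiliary variables $a_1,\dots,a_{m-1}$, functions $\psi_0,\dots,\psi_{m-1}$ and sets $\mathcal{B}_0,\dots,\mathcal{B}_{m-2}$. Suppose $h(\boldsymbol{x}(0))>0$ and $(\boldsymbol{x}(0),\boldsymbol{\Pi}(0))\in\mathcal{B}_0\cap\dots\cap\mathcal{B}_{m-2}$. Let $C_{\int}(t)=\int_0^t c(\tau)\,d\tau$, let $C_{\int}^{-1}$ denote the inverse function of $C_{\int}$, and set $$T=C_{\int}^{-1}\!\left(C_{\int}(0)+\frac{h(\boldsymbol{x}(0))^{1-q}}{1-q}\right).$$ Then any controller $\boldsymbol{u}\in\mathcal{U}$, $\boldsymbol{\nu}\in\mathcal{U}_{\boldsymbol{a}}$ that satisfies the AVCLBF constraint $\psi_{m-1}\ge 0$ for all $t\ge 0$ makes $h(\boldsymbol{x})$ reach $0$ within time $T$; that is,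 there exists $t_r\in[0,T]$ with $h(\boldsymbol{x}(t_r))=0$.
   Context: Class $\kappa$ function: a continuous strictly increasing $\alpha:[0,a)\to[0,\infty]$, $a>0$, with $\alpha(0)=0$. Extended class $\kappa$ function: a continuous strictly increasing $\alpha:\mathbb{R}\to\mathbb{R}$ with $\alpha(0)=0$. Relative degree of a function along a control system: the minimum number of times it must be differentiated along the dynamics until some component of the control appears explicitly. All functions are assumed smooth enough for the derivatives below to exist. Auxiliary systems. For $i\in\{1,\dots,m-1\}$ there is an auxiliary state $\boldsymbol{\pi}_i(t)\in\mathbb{R}^{m-i}$ with dynamics $\dot{\boldsymbol{\pi}}_i=F_i(\boldsymbol{\pi}_i)+G_i(\boldsymbol{\pi}_i)\nu_i$, where $\nu_i\in\mathbb{R}$ is an auxiliary input and $F_i,G_i:\mathbb{R}^{m-i}\to\mathbb{R}^{m-i}$ are locally Lipschitz, and an auxiliary variable $a_i(t)$, a function of $\boldsymbol{\pi}_i(t)$ of relative degree $m-i$ (for example $a_i=\pi_{i,1}$, $\dot\pi_{i,1}=\pi_{i,2}$, $\dots$, $\dot\pi_{i,m-i}=\nu_i$). Write $\boldsymbol{\Pi}=(\boldsymbol{\pi}_1,\dots,\boldsymbol{\pi}_{m-1})$ and $\boldsymbol{\nu}=(\nu_1,\dots,\nu_{m-1})$. Positivity of $a_i$. Set $\varphi_{i,0}=a_i$ and $\varphi_{i,j}=\dot\varphi_{i,j-1}+\alpha_{i,j}(\varphi_{i,j-1})$ for $j\in\{1,\dots,m-i\}$, where $\alpha_{i,j}$ is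 an $(m-i-j)$-times differentiable class $\kappa$ function. "$a_i$ is a HOCBF (High-Order Control Barrier Function) of relative degree $m-i$ for its auxiliary system" means that $\sup_{\nu_i}\varphi_{i,m-i}\ge 0$ whenever $\varphi_{i,0},\dots,\varphi_{i,m-i-1}\ge 0$. For a fixed constant $\epsilon>0$, $\mathcal{U}_{\boldsymbol{a}}(\boldsymbol{\Pi})=\{\boldsymbol{\nu}\in\mathbb{R}^{m-1}:\varphi_{i,m-i}(\boldsymbol{\pi}_i,\nu_i)\ge\epsilon,\ i=1,\dots,m-1\}$. It is a standing assumption that this construction keeps each auxiliary variable positive: $a_i(t)>0$ for all $t\ge0$ and all $i$. AVCLBF. Let $c(t)$ be a time-varying real function and $\beta$ an extended class $\kappa$ function. With time derivatives taken along the closed-loop system and auxiliary systems, define $$\psi_0=a_1(t)\bigl(-\dot h(\boldsymbol{x})-c(t)\beta(h(\boldsymbol{x}))\bigr),$$ $$\psi_i=a_{i+1}(t)\bigl(\dot\psi_{i-1}+\alpha_i(\psi_{i-1})\bigr),\quad i\in\{1,\dots,m-2\},$$ $$\psi_{m-1}=\dot\psi_{m-2}+\alpha_{m-1}(\psi_{m-2}),$$ where $\alpha_j$ is an $(m-1-j)$-times differentiable class $\kappa$ function for $j\in\{1,\dots,m-2\}$ and $\alpha_{m-1}$ is a class $\kappa$ function. The inputs $\boldsymbol{u},\boldsymbol{\nu}$ appear explicitly only in $\psi_{m-1}$. Define $\mathcal{B}_i=\{(\boldsymbol{x},\boldsymbol{\Pi}):\psi_i(\boldsymbol{x},\boldsymbol{\Pi})\ge0\}$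 for $i\in\{0,\dots,m-2\}$. The function $h$, of relative degree $m\ge2$ for the control system, is an AVCLBF if every $a_i$ is a HOCBF of relative degree $m-i$ for its auxiliary system and there exist $(m-1-j)$-times differentiable class $\kappa$ functions $\alpha_j$, $j\in\{1,\dots,m-2\}$, and a class $\kappa$ function $\alpha_{m-1}$ such that $\sup_{\boldsymbol{u}\in\mathcal{U},\,\boldsymbol{\nu}\in\mathcal{U}_{\boldsymbol{a}}}\psi_{m-1}\ge0$ for all $(\boldsymbol{x},\boldsymbol{\Pi})\in\mathcal{B}_0\cap\dots\cap\mathcal{B}_{m-2}$ with each $a_i>0$. It is implicit that $C_{\int}$ is invertible and that $C_{\int}(0)+\frac{h(\boldsymbol{x}(0))^{1-q}}{1-q}$ lies in its range, so that $T$ is well defined, and that the closed-loop trajectory exists for all $t\ge0$. *)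

theory Defs
  imports "HOL-Analysis.Analysis" "HOL-Analysis.Finite_Function_Topology"
begin

text \<open>
  The auxiliary states live in spaces whose dimension depends on the index of the auxiliary
  system, so \<open>\<real>\<^sup>d\<close> with a variable \<open>d\<close> is the \<open>d\<close>-dimensional coordinate subspace \<open>rvec d\<close> of the
  normed space of finitely supported real sequences.  Its norm is the 1-norm; differentiability
  and the local Lipschitz property do not depend on that choice.
\<close>

type_synonym fvec = "nat \<Rightarrow>\<^sub>0 real"

definition rvec :: "nat \<Rightarrow> fvec set" where
  "rvec d = {v. Poly_Mapping.keys v \<subseteq> {1..d}}"

definition locally_lipschitz :: "'s::metric_space set \<Rightarrow> ('s \<Rightarrow> 'r::metric_space) \<Rightarrow> bool" where
  "locally_lipschitz S F \<longleftrightarrow> local_lipschitz (UNIV :: real set) S (\<lambda>_. F)"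

text \<open>
  \<open>class_kappa \<rho> \<alpha>\<close>: the restriction of \<open>\<alpha>\<close> to \<open>[0,\<rho>)\<close>, \<open>0 < \<rho> \<le> \<infinity>\<close>, is a class \<open>\<kappa>\<close> function.
  (A strictly increasing function on \<open>[0,\<rho>)\<close> never attains the value \<open>\<infinity>\<close>, so real values suffice.)
\<close>

definition kappa_dom :: "ereal \<Rightarrow> real set" where
  "kappa_dom \<rho> = {s. 0 \<le> s \<and> ereal s < \<rho>}"

definition class_kappa :: "ereal \<Rightarrow> (real \<Rightarrow> real) \<Rightarrow> bool" where
  "class_kappa \<rho> \<alpha> \<longleftrightarrow>
     0 < \<rho> \<and> continuous_on (kappa_dom \<rho>) \<alpha> \<and> strict_mono_on (kappa_dom \<rho>) \<alpha> \<and> \<alpha> 0 = 0"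

definition extended_class_kappa :: "(real \<Rightarrow> real) \<Rightarrow> bool" where
  "extended_class_kappa \<beta> \<longleftrightarrow> continuous_on UNIV \<beta> \<and> strict_mono \<beta> \<and> \<beta> 0 = 0"

definition times_differentiable :: "nat \<Rightarrow> ereal \<Rightarrow> (real \<Rightarrow> real) \<Rightarrow> bool" where
  "times_differentiable k \<rho> \<alpha> \<longleftrightarrow>
     (\<exists>D :: nat \<Rightarrow> real \<Rightarrow> real.
        (\<forall>s\<in>kappa_dom \<rho>. D 0 s = \<alpha> s) \<and>
        (\<forall>j<k. \<forall>s\<in>kappa_dom \<rho>. (D j has_real_derivative D (Suc j) s) (at s within kappa_dom \<rho>)))"

text \<open>
  A class \<open>\<kappa>\<close> function has no values at negative arguments, while the functions \<open>\<psi>\<^sub>i\<close> below may be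
  negative.  Any extension to negative arguments is admitted which, immediately to the left of
  \<open>0\<close>, is bounded above by a linear function.  This covers every increasing (in particular
  extended class \<open>\<kappa>\<close>) extension and every extension that is Lipschitz near \<open>0\<close>, such as that of a
  polynomial by itself; it excludes e.g. \<open>\<alpha> s = sqrt \<bar>s\<bar>\<close>, for which \<open>\<psi>' + \<alpha> \<psi> \<ge> 0\<close> does not keep
  \<open>\<psi>\<close> nonnegative.
\<close>

definition admissible_extension :: "(real \<Rightarrow> real) \<Rightarrow> bool" where
  "admissible_extension \<alpha> \<longleftrightarrow> (\<exists>\<delta>>0. \<exists>L. \<forall>s. - \<delta> < s \<and> s < 0 \<longrightarrow> \<alpha> s \<le> L * \<bar>s\<bar>)"

text \<open>The derivative of \<open>\<phi>\<close> at the state \<open>s\<close> in the direction \<open>v\<close>; with \<open>v\<close> the right-hand side of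
  the dynamics this is the time derivative of \<open>\<phi>\<close> along the dynamics.\<close>

definition lie :: "('s::real_normed_vector \<Rightarrow> real) \<Rightarrow> 's \<Rightarrow> 's \<Rightarrow> real" where
  "lie \<phi> s v = deriv (\<lambda>r::real. \<phi> (s + r *\<^sub>R v)) 0"

text \<open>
  A control system is given by its right-hand side \<open>dyn\<close>, depending on state and input.
  \<open>drift_deriv dyn \<phi> k\<close> is the \<open>k\<close>-th time derivative of \<open>\<phi>\<close> as long as no input has appeared, which
  is why the input may be set to \<open>0\<close> in it.
\<close>

primrec drift_deriv ::
  "('s::real_normed_vector \<Rightarrow> 'i::zero \<Rightarrow> 's) \<Rightarrow> ('s \<Rightarrow> real) \<Rightarrow> nat \<Rightarrow> 's \<Rightarrow> real" where
  "drift_deriv dyn \<phi> 0 = \<phi>"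
| "drift_deriv dyn \<phi> (Suc k) = (\<lambda>s. lie (drift_deriv dyn \<phi> k) s (dyn s 0))"

definition relative_degree ::
  "'s::real_normed_vector set \<Rightarrow> ('s \<Rightarrow> 'i::zero \<Rightarrow> 's) \<Rightarrow> ('s \<Rightarrow> real) \<Rightarrow> nat \<Rightarrow> bool" where
  "relative_degree S dyn \<phi> r \<longleftrightarrow>
     0 < r \<and>
     (\<forall>k<r. drift_deriv dyn \<phi> k differentiable_on S) \<and>
     (\<forall>k. Suc k < r \<longrightarrow> (\<forall>s\<in>S. \<forall>w.
         lie (drift_deriv dyn \<phi> k) s (dyn s w) = lie (drift_deriv dyn \<phi> k) s (dyn s 0))) \<and>
     (\<exists>s\<in>S. \<exists>w.
         lie (drift_deriv dyn \<phi> (r - 1)) s (dyn s w) \<noteq> lie (drift_deriv dyn \<phi> (r - 1)) s (dyn s 0))"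

text \<open>The functions \<open>\<phi>\<^sub>0 = b\<close>, \<open>\<phi>\<^sub>j = d/dt \<phi>\<^sub>j\<^sub>-\<^sub>1 + \<alpha>\<^sub>j(\<phi>\<^sub>j\<^sub>-\<^sub>1)\<close>; only the last one of them depends on the
  input.\<close>

primrec ho_fun ::
  "('s::real_normed_vector \<Rightarrow> 'i::zero \<Rightarrow> 's) \<Rightarrow> ('s \<Rightarrow> real) \<Rightarrow> (nat \<Rightarrow> real \<Rightarrow> real) \<Rightarrow>
   nat \<Rightarrow> 's \<Rightarrow> 'i \<Rightarrow> real" where
  "ho_fun dyn b \<alpha> 0 = (\<lambda>s w. b s)"
| "ho_fun dyn b \<alpha> (Suc j) =
     (\<lambda>s w. lie (\<lambda>s'. ho_fun dyn b \<alpha> j s' 0) s (dyn s w) + \<alpha> (Suc j) (ho_fun dyn b \<alpha> j s 0))"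

text \<open>States at which every argument of a class \<open>\<kappa>\<close> function \<open>\<alpha>\<^sub>j\<close> stays below its radius \<open>\<rho>\<^sub>j\<close>.\<close>

definition ho_dom ::
  "'s::real_normed_vector set \<Rightarrow> ('s \<Rightarrow> 'i::zero \<Rightarrow> 's) \<Rightarrow> ('s \<Rightarrow> real) \<Rightarrow>
   (nat \<Rightarrow> ereal) \<Rightarrow> (nat \<Rightarrow> real \<Rightarrow> real) \<Rightarrow> nat \<Rightarrow> 's set" where
  "ho_dom S dyn b \<rho> \<alpha> r = {s\<in>S. \<forall>j\<in>{1..r}. ereal (ho_fun dyn b \<alpha> (j - 1) s 0) < \<rho> j}"

definition HOCBF ::
  "'s::real_normed_vector set \<Rightarrow> ('s \<Rightarrow> 'i::zero \<Rightarrow> 's) \<Rightarrow> ('s \<Rightarrow> real) \<Rightarrow>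
   (nat \<Rightarrow> ereal) \<Rightarrow> (nat \<Rightarrow> real \<Rightarrow> real) \<Rightarrow> nat \<Rightarrow> bool" where
  "HOCBF S dyn b \<rho> \<alpha> r \<longleftrightarrow>
     relative_degree S dyn b r \<and>
     (\<forall>j\<in>{1..r}. class_kappa (\<rho> j) (\<alpha> j) \<and> times_differentiable (r - j) (\<rho> j) (\<alpha> j)) \<and>
     (\<forall>s\<in>ho_dom S dyn b \<rho> \<alpha> r. \<forall>j<r. (\<lambda>s'. ho_fun dyn b \<alpha> j s' 0) differentiable (at s within S)) \<and>
     (\<forall>s\<in>ho_dom S dyn b \<rho> \<alpha> r.
        (\<forall>j<r. 0 \<le> ho_fun dyn b \<alpha> j s 0) \<longrightarrow> 0 \<le> (SUP w. ereal (ho_fun dyn b \<alpha> r s w)))"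

text \<open>The control system and the auxiliary systems; \<open>Poly_Mapping.lookup \<pi> i\<close> is \<open>\<pi>\<^sub>i\<close>.\<close>

type_synonym auxstate = "nat \<Rightarrow>\<^sub>0 fvec"

definition ctrl_dyn ::
  "(real^'n \<Rightarrow> real^'n) \<Rightarrow> (real^'n \<Rightarrow> real^'p^'n) \<Rightarrow> real^'n \<Rightarrow> real^'p \<Rightarrow> real^'n" where
  "ctrl_dyn f g x u = f x + g x *v u"

definition aux_dyn ::
  "(nat \<Rightarrow> fvec \<Rightarrow> fvec) \<Rightarrow> (nat \<Rightarrow> fvec \<Rightarrow> fvec) \<Rightarrow> nat \<Rightarrow> fvec \<Rightarrow> real \<Rightarrow> fvec" where
  "aux_dyn F G i p v = F i p + v *\<^sub>R G i p"

definition aux_space :: "nat \<Rightarrow> auxstate set" where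
  "aux_space m = {\<pi>. Poly_Mapping.keys \<pi> \<subseteq> {1..m - 1} \<and>
                     (\<forall>i\<in>{1..m - 1}. Poly_Mapping.lookup \<pi> i \<in> rvec (m - i))}"

definition aux_field ::
  "nat \<Rightarrow> (nat \<Rightarrow> fvec \<Rightarrow> fvec) \<Rightarrow> (nat \<Rightarrow> fvec \<Rightarrow> fvec) \<Rightarrow> auxstate \<Rightarrow> fvec \<Rightarrow> auxstate" where
  "aux_field m F G \<pi> \<nu> =
     (\<Sum>i\<in>{1..m - 1}. Poly_Mapping.single i
        (aux_dyn F G i (Poly_Mapping.lookup \<pi> i) (Poly_Mapping.lookup \<nu> i)))"

definition aux_inputs ::
  "nat \<Rightarrow> (nat \<Rightarrow> fvec \<Rightarrow> fvec) \<Rightarrow> (nat \<Rightarrow> fvec \<Rightarrow> fvec) \<Rightarrow> (nat \<Rightarrow> fvec \<Rightarrow> real) \<Rightarrow>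
   (nat \<Rightarrow> nat \<Rightarrow> real \<Rightarrow> real) \<Rightarrow> real \<Rightarrow> auxstate \<Rightarrow> fvec set" where
  "aux_inputs m F G a \<gamma> \<epsilon> \<pi> =
     {\<nu>\<in>rvec (m - 1). \<forall>i\<in>{1..m - 1}.
        \<epsilon> \<le> ho_fun (aux_dyn F G i) (a i) (\<gamma> i) (m - i)
               (Poly_Mapping.lookup \<pi> i) (Poly_Mapping.lookup \<nu> i)}"

text \<open>
  Since \<open>c\<close> depends explicitly on time, the functions \<open>\<psi>\<^sub>i\<close> are functions of \<open>(x, \<pi>, t)\<close>, where time
  evolves with rate \<open>1\<close>; values of \<open>c\<close> at negative times merely serve as a smooth extension, so
  that derivatives at \<open>t = 0\<close> are two-sided.  Inputs are pairs \<open>(u, \<nu>)\<close>.  The factor \<open>a\<^sub>i\<^sub>+\<^sub>1\<close> is absent from the last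
  function \<open>\<psi>\<^sub>m\<^sub>-\<^sub>1\<close>, the only one that depends on the input.
\<close>

type_synonym 'n tstate = "(real^'n) \<times> auxstate \<times> real"

fun full_dyn ::
  "(real^'n \<Rightarrow> real^'n) \<Rightarrow> (real^'n \<Rightarrow> real^'p^'n) \<Rightarrow>
   nat \<Rightarrow> (nat \<Rightarrow> fvec \<Rightarrow> fvec) \<Rightarrow> (nat \<Rightarrow> fvec \<Rightarrow> fvec) \<Rightarrow>
   'n::finite tstate \<Rightarrow> (real^'p) \<times> fvec \<Rightarrow> 'n tstate" where
  "full_dyn f g m F G (x, \<pi>, t) (u, \<nu>) = (ctrl_dyn f g x u, aux_field m F G \<pi> \<nu>, 1)"

primrec psi ::
  "(real^'n \<Rightarrow> real^'n) \<Rightarrow> (real^'n \<Rightarrow> real^'p^'n) \<Rightarrow> (real^'n \<Rightarrow> real) \<Rightarrow>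
   (real \<Rightarrow> real) \<Rightarrow> (real \<Rightarrow> real) \<Rightarrow>
   nat \<Rightarrow> (nat \<Rightarrow> fvec \<Rightarrow> fvec) \<Rightarrow> (nat \<Rightarrow> fvec \<Rightarrow> fvec) \<Rightarrow> (nat \<Rightarrow> fvec \<Rightarrow> real) \<Rightarrow>
   (nat \<Rightarrow> real \<Rightarrow> real) \<Rightarrow> nat \<Rightarrow> 'n::finite tstate \<Rightarrow> (real^'p) \<times> fvec \<Rightarrow> real" where
  "psi f g h \<beta> c m F G a \<alpha> 0 =
     (\<lambda>(x, \<pi>, t) (u, \<nu>).
        a 1 (Poly_Mapping.lookup \<pi> 1) * (- lie h x (ctrl_dyn f g x u) - c t * \<beta> (h x)))"
| "psi f g h \<beta> c m F G a \<alpha> (Suc i) =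
     (\<lambda>z w.
        (if Suc i < m - 1 then a (i + 2) (Poly_Mapping.lookup (fst (snd z)) (i + 2)) else 1) *
        (lie (\<lambda>z'. psi f g h \<beta> c m F G a \<alpha> i z' (0, 0)) z (full_dyn f g m F G z w)
           + \<alpha> (Suc i) (psi f g h \<beta> c m F G a \<alpha> i z (0, 0))))"

definition tspace :: "nat \<Rightarrow> ('n::finite) tstate set" where
  "tspace m = {(x, \<pi>, t). \<pi> \<in> aux_space m}"

text \<open>
  The points where all \<open>\<psi>\<^sub>i\<close> are meaningful: the arguments of the class \<open>\<kappa>\<close> functions stay below
  their radii, and \<open>h x \<noteq> 0\<close> because \<open>\<beta>(h) = h\<^sup>q\<close>, \<open>0 < q < 1\<close>, is not differentiable at \<open>h = 0\<close>.
\<close>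

definition psi_dom ::
  "(real^'n \<Rightarrow> real^'n) \<Rightarrow> (real^'n \<Rightarrow> real^'p^'n) \<Rightarrow> (real^'n \<Rightarrow> real) \<Rightarrow>
   (real \<Rightarrow> real) \<Rightarrow> (real \<Rightarrow> real) \<Rightarrow>
   nat \<Rightarrow> (nat \<Rightarrow> fvec \<Rightarrow> fvec) \<Rightarrow> (nat \<Rightarrow> fvec \<Rightarrow> fvec) \<Rightarrow> (nat \<Rightarrow> fvec \<Rightarrow> real) \<Rightarrow>
   (nat \<Rightarrow> ereal) \<Rightarrow> (nat \<Rightarrow> real \<Rightarrow> real) \<Rightarrow> 'n::finite tstate set" where
  "psi_dom f g h \<beta> c m F G a \<rho> \<alpha> =
     {(x, \<pi>, t). \<pi> \<in> aux_space m \<and> 0 \<le> t \<and> h x \<noteq> 0 \<and>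
        (\<forall>j\<in>{1..m - 1}. ereal (psi f g h \<beta> c m F G a \<alpha> (j - 1) (x, \<pi>, t) (0, 0)) < \<rho> j)}"

definition B_set ::
  "(real^'n \<Rightarrow> real^'n) \<Rightarrow> (real^'n \<Rightarrow> real^'p^'n) \<Rightarrow> (real^'n \<Rightarrow> real) \<Rightarrow>
   (real \<Rightarrow> real) \<Rightarrow> (real \<Rightarrow> real) \<Rightarrow>
   nat \<Rightarrow> (nat \<Rightarrow> fvec \<Rightarrow> fvec) \<Rightarrow> (nat \<Rightarrow> fvec \<Rightarrow> fvec) \<Rightarrow> (nat \<Rightarrow> fvec \<Rightarrow> real) \<Rightarrow>
   (nat \<Rightarrow> real \<Rightarrow> real) \<Rightarrow> nat \<Rightarrow> real \<Rightarrow> ((real^'n::finite) \<times> auxstate) set" where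
  "B_set f g h \<beta> c m F G a \<alpha> i t = {(x, \<pi>). 0 \<le> psi f g h \<beta> c m F G a \<alpha> i (x, \<pi>, t) (0, 0)}"

text \<open>
  \<open>\<sigma> i\<close>, \<open>\<gamma> i\<close> are the radii and class \<open>\<kappa>\<close> functions witnessing that \<open>a i\<close> is a HOCBF; \<open>\<rho>\<close>, \<open>\<alpha>\<close> are
  those witnessing that \<open>h\<close> is an AVCLBF and defining the \<open>\<psi>\<^sub>i\<close>.  The fourth and fifth conjuncts say
  that the derivatives occurring in the \<open>\<psi>\<^sub>i\<close> exist and that the inputs appear only in \<open>\<psi>\<^sub>m\<^sub>-\<^sub>1\<close>.
\<close>

definition AVCLBF ::
  "(real^'n \<Rightarrow> real^'n) \<Rightarrow> (real^'n \<Rightarrow> real^'p^'n) \<Rightarrow> (real^'p) set \<Rightarrow> (real^'n \<Rightarrow> real) \<Rightarrow>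
   (real \<Rightarrow> real) \<Rightarrow> (real \<Rightarrow> real) \<Rightarrow>
   nat \<Rightarrow> (nat \<Rightarrow> fvec \<Rightarrow> fvec) \<Rightarrow> (nat \<Rightarrow> fvec \<Rightarrow> fvec) \<Rightarrow> (nat \<Rightarrow> fvec \<Rightarrow> real) \<Rightarrow>
   (nat \<Rightarrow> nat \<Rightarrow> ereal) \<Rightarrow> (nat \<Rightarrow> nat \<Rightarrow> real \<Rightarrow> real) \<Rightarrow> real \<Rightarrow>
   (nat \<Rightarrow> ereal) \<Rightarrow> (nat \<Rightarrow> real \<Rightarrow> real) \<Rightarrow> bool" where
  "AVCLBF f g U h \<beta> c m F G a \<sigma> \<gamma> \<epsilon> \<rho> \<alpha> \<longleftrightarrow>
     relative_degree UNIV (ctrl_dyn f g) h m \<and>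
     (\<forall>i\<in>{1..m - 1}. HOCBF (rvec (m - i)) (aux_dyn F G i) (a i) (\<sigma> i) (\<gamma> i) (m - i)) \<and>
     (\<forall>j\<in>{1..m - 1}. class_kappa (\<rho> j) (\<alpha> j) \<and> times_differentiable (m - 1 - j) (\<rho> j) (\<alpha> j)
                      \<and> admissible_extension (\<alpha> j)) \<and>
     (\<forall>z\<in>psi_dom f g h \<beta> c m F G a \<rho> \<alpha>. \<forall>i<m - 1.
        (\<lambda>z'. psi f g h \<beta> c m F G a \<alpha> i z' (0, 0)) differentiable (at z within tspace m)) \<and>
     (\<forall>z\<in>psi_dom f g h \<beta> c m F G a \<rho> \<alpha>. \<forall>i<m - 1. \<forall>u. \<forall>\<nu>\<in>rvec (m - 1).
        psi f g h \<beta> c m F G a \<alpha> i z (u, \<nu>) = psi f g h \<beta> c m F G a \<alpha> i z (0, 0)) \<and>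
     (\<forall>x \<pi> t. (x, \<pi>, t) \<in> psi_dom f g h \<beta> c m F G a \<rho> \<alpha> \<longrightarrow>
        (\<forall>i<m - 1. (x, \<pi>) \<in> B_set f g h \<beta> c m F G a \<alpha> i t) \<longrightarrow>
        (\<forall>i\<in>{1..m - 1}. 0 < a i (Poly_Mapping.lookup \<pi> i)) \<longrightarrow>
        0 \<le> (SUP w\<in>U \<times> aux_inputs m F G a \<gamma> \<epsilon> \<pi>.
               ereal (psi f g h \<beta> c m F G a \<alpha> (m - 1) (x, \<pi>, t) w)))"

text \<open>\<open>C\<^sub>\<integral>\<close> is only used on \<open>t \<ge> 0\<close>.\<close>

definition c_int :: "(real \<Rightarrow> real) \<Rightarrow> real \<Rightarrow> real" where
  "c_int c t = integral {0..t} c"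

end

theory Submission
  imports Defs
begin

text \<open>
  Suppose \<open>h\<close> does not vanish along the trajectory up to time \<open>T\<close>; then it stays positive there.
  The auxiliary variables are positive, so \<open>\<psi>\<^sub>i \<ge> 0\<close> along the trajectory gives
  \<open>d/dt \<psi>\<^sub>i\<^sub>-\<^sub>1 + \<alpha>\<^sub>i(\<psi>\<^sub>i\<^sub>-\<^sub>1) \<ge> 0\<close>, and a comparison argument gives \<open>\<psi>\<^sub>i\<^sub>-\<^sub>1 \<ge> 0\<close>.  Descending from the
  constraint \<open>\<psi>\<^sub>m\<^sub>-\<^sub>1 \<ge> 0\<close> one reaches \<open>\<psi>\<^sub>0 \<ge> 0\<close>, that is \<open>d/dt h \<le> - c h\<^sup>q\<close>.  Hence
  \<open>h\<^sup>1\<^sup>-\<^sup>q / (1 - q) + C\<^sub>\<integral>\<close> is nonincreasing, and the choice of \<open>T\<close> forces \<open>h \<le> 0\<close> at time \<open>T\<close>.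
\<close>

section \<open>Derivatives along curves\<close>

text \<open>\<open>lie\<close> differentiates along the whole line through \<open>s\<close>, while
  differentiability is known only within \<open>S\<close>. A subspace contains that line, so the
  chain rule applies with the derivative restricted to it.\<close>

lemma lie_eq_has_derivative:
  assumes "subspace S" "s \<in> S" "v \<in> S" "(\<phi> has_derivative D) (at s within S)"
  shows "lie \<phi> s v = D v"
proof -
  have line: "((\<lambda>r. s + r *\<^sub>R v) has_vector_derivative v) (at (0::real))"
    by (auto intro!: derivative_eq_intros)
  have "range (\<lambda>r::real. s + r *\<^sub>R v) \<subseteq> S"
    using assms(1-3) by (auto intro: subspace_add subspace_scale)
  then have "(\<phi> has_derivative D) (at (s + 0 *\<^sub>R v) within range (\<lambda>r::real. s + r *\<^sub>R v))"
    using assms(4) by (auto intro: has_derivative_subset)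
  from vector_derivative_diff_chain_within[OF line this]
  have "((\<lambda>r. \<phi> (s + r *\<^sub>R v)) has_real_derivative D v) (at 0)"
    by (simp add: o_def has_real_derivative_iff_has_vector_derivative)
  then show ?thesis
    unfolding lie_def by (rule DERIV_imp_deriv)
qed

text \<open>This turns the directional derivatives in \<open>psi\<close> into genuine time
  derivatives along a trajectory. For a closed interval \<open>I\<close> they are one-sided at its
  ends.\<close>

lemma has_real_derivative_lie:
  assumes S: "subspace S" and \<phi>: "\<phi> differentiable (at (z t) within S)"
    and z: "(z has_vector_derivative v) (at t within I)"
    and mem: "z ` I \<subseteq> S" "z t \<in> S" "v \<in> S"
  shows "((\<lambda>t. \<phi> (z t)) has_real_derivative lie \<phi> (z t) v) (at t within I)"
proof -
  obtain D where D: "(\<phi> has_derivative D) (at (z t) within S)"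
    using \<phi> by (auto simp: differentiable_def)
  have "(\<phi> has_derivative D) (at (z t) within z ` I)"
    using D mem(1) by (rule has_derivative_subset)
  from vector_derivative_diff_chain_within[OF z this] show ?thesis
    by (simp add: o_def has_real_derivative_iff_has_vector_derivative
        lie_eq_has_derivative[OF S mem(2,3) D])
qed

section \<open>The state space of the auxiliary systems\<close>

lemma lookup_scaleR: "Poly_Mapping.lookup (r *\<^sub>R v) k = r *\<^sub>R Poly_Mapping.lookup v k"
proof -
  have "finite {k. r *\<^sub>R Poly_Mapping.lookup v k \<noteq> 0}"
    by (rule finite_subset[OF _ finite_keys[of v]]) (auto simp: in_keys_iff)
  then show ?thesis
    by (simp add: scaleR_poly_mapping_def)
qed

lemma keys_subset_iff_lookup: "Poly_Mapping.keys v \<subseteq> A \<longleftrightarrow> (\<forall>k. k \<notin> A \<longrightarrow> Poly_Mapping.lookup v k = 0)"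
  by (auto simp: in_keys_iff)

lemma subspace_rvec: "subspace (rvec d)"
  unfolding rvec_def keys_subset_iff_lookup
  by (auto simp: subspace_def lookup_add lookup_scaleR)

lemma subspace_aux_space: "subspace (aux_space m)"
  unfolding aux_space_def keys_subset_iff_lookup
  by (auto simp: subspace_def lookup_add lookup_scaleR
      intro: subspace_0 subspace_add subspace_scale subspace_rvec)

lemma subspace_tspace: "subspace (tspace m)"
  using subspace_aux_space[of m]
  by (auto simp: subspace_def tspace_def zero_prod_def)

lemma lookup_aux_field:
  "Poly_Mapping.lookup (aux_field m F G \<pi> \<nu>) k =
     (if k \<in> {1..m - 1} then aux_dyn F G k (Poly_Mapping.lookup \<pi> k) (Poly_Mapping.lookup \<nu> k) else 0)"
  by (simp add: aux_field_def lookup_sum lookup_single when_def)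

text \<open>Supplies the auxiliary component of the velocity condition \<open>v \<in> S\<close> of
  \<open>has_real_derivative_lie\<close>.\<close>

lemma aux_field_in_aux_space:
  assumes "\<And>i. i \<in> {1..m - 1} \<Longrightarrow> F i ` rvec (m - i) \<subseteq> rvec (m - i)"
    and "\<And>i. i \<in> {1..m - 1} \<Longrightarrow> G i ` rvec (m - i) \<subseteq> rvec (m - i)"
    and "\<pi> \<in> aux_space m"
  shows "aux_field m F G \<pi> \<nu> \<in> aux_space m"
proof -
  have "aux_dyn F G i (Poly_Mapping.lookup \<pi> i) w \<in> rvec (m - i)" if i: "i \<in> {1..m - 1}" for i w
  proof -
    have "Poly_Mapping.lookup \<pi> i \<in> rvec (m - i)"
      using assms(3) i by (auto simp: aux_space_def)
    then show ?thesis
      unfolding aux_dyn_def using assms(1,2)[OF i]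
      by (intro subspace_add subspace_scale subspace_rvec) auto
  qed
  then show ?thesis
    by (auto simp: aux_space_def keys_subset_iff_lookup lookup_aux_field)
qed

section \<open>Comparison arguments\<close>

text \<open>If \<psi> became negative, then just after its last nonnegative time it would lie in
  \<open>(-\<delta>, 0)\<close>. There the bound on \<alpha> gives the linear inequality
  \<open>\<psi>' \<ge> L * \<psi>\<close>, so \<open>\<psi> t * exp (- L * t)\<close> is
  nondecreasing and cannot pass from a nonnegative to a negative value.\<close>

lemma nonneg_of_deriv_plus_kappa_nonneg:
  fixes \<psi> :: "real \<Rightarrow> real"
  assumes \<alpha>: "admissible_extension \<alpha>"
    and init: "0 \<le> \<psi> a"
    and deriv: "\<And>t. t \<in> {a..b} \<Longrightarrow> (\<psi> has_real_derivative \<psi>' t) (at t within {a..b})"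
    and ineq: "\<And>t. t \<in> {a..b} \<Longrightarrow> 0 \<le> \<psi>' t + \<alpha> (\<psi> t)"
    and s: "s \<in> {a..b}"
  shows "0 \<le> \<psi> s"
proof (rule ccontr)
  assume neg: "\<not> 0 \<le> \<psi> s"
  obtain \<delta> L where \<delta>: "0 < \<delta>" and L: "\<And>r. - \<delta> < r \<Longrightarrow> r < 0 \<Longrightarrow> \<alpha> r \<le> L * \<bar>r\<bar>"
    using \<alpha> unfolding admissible_extension_def by blast
  have cont: "continuous_on {a..b} \<psi>"
    using deriv DERIV_continuous unfolding continuous_on_eq_continuous_within by blast
  let ?K = "{a..s} \<inter> \<psi> -` {0..}"
  have "closed ?K"
    by (rule continuous_closed_preimage) (use s in \<open>auto intro: continuous_on_subset[OF cont]\<close>)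
  then have "compact ?K"
    using compact_Int_closed[of "{a..s}" ?K] by (simp add: Int_absorb1)
  moreover have "?K \<noteq> {}"
    using init s by auto
  ultimately obtain t0 where "t0 \<in> ?K" and K: "\<forall>t\<in>?K. t \<le> t0"
    using compact_attains_sup by blast
  then have t0: "t0 \<in> {a..s}" "0 \<le> \<psi> t0"
    by auto
  have last: "t \<le> t0" if "t \<in> {a..s}" "0 \<le> \<psi> t" for t
    using K that by auto
  have "t0 < s"
    using t0 neg by (cases "t0 = s") auto
  obtain d where d: "0 < d" "\<And>t. t \<in> {a..b} \<Longrightarrow> dist t t0 < d \<Longrightarrow> dist (\<psi> t) (\<psi> t0) < \<delta>"
    using cont t0(1) s \<delta> unfolding continuous_on_iff by force
  \<comment> \<open>Halving \<open>d\<close> keeps \<open>s'\<close> strictly inside the continuity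
    radius. On \<open>(t0, s']\<close> both bounds in \<open>small\<close> then hold: \<psi> is
    negative because \<open>t0\<close> is the last nonnegative time, and above
    \<open>-\<delta>\<close> because \<open>\<psi> t0 \<ge> 0\<close>.\<close>
  define s' where "s' = min s (t0 + d / 2)"
  have s': "t0 < s'" "s' \<le> s" "s' < t0 + d"
    using \<open>t0 < s\<close> d(1) by (auto simp: s'_def)
  have small: "- \<delta> < \<psi> t" "\<psi> t < 0" if "t0 < t" "t \<le> s'" for t
  proof -
    have "dist (\<psi> t) (\<psi> t0) < \<delta>"
      using that s' t0 s by (intro d(2)) (auto simp: dist_real_def)
    then show "- \<delta> < \<psi> t"
      using t0(2) by (auto simp: dist_real_def)
    show "\<psi> t < 0"
      using last[of t] that s' t0 by force
  qed
  have "\<psi> t0 * exp (- L * t0) \<le> \<psi> s' * exp (- L * s')"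
  proof (rule DERIV_nonneg_imp_increasing_open[where f = "\<lambda>t. \<psi> t * exp (- L * t)"])
    show "t0 \<le> s'"
      using s' by simp
    show "continuous_on {t0..s'} (\<lambda>t. \<psi> t * exp (- L * t))"
      using t0 s s' by (intro continuous_intros continuous_on_subset[OF cont]) auto
    fix t assume t: "t0 < t" "t < s'"
    have "t \<in> {a..b}" and "t \<in> {a<..<b}"
      using t t0 s s' by auto
    then have "(\<psi> has_real_derivative \<psi>' t) (at t)"
      using deriv[of t] by (auto simp: at_within_Icc_at)
    then have "((\<lambda>t. \<psi> t * exp (- L * t)) has_real_derivative (\<psi>' t - L * \<psi> t) * exp (- L * t)) (at t)"
      by (auto intro!: derivative_eq_intros simp: algebra_simps)
    moreover have "\<alpha> (\<psi> t) \<le> - L * \<psi> t"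
      using L[of "\<psi> t"] small[of t] t by auto
    then have "0 \<le> \<psi>' t - L * \<psi> t"
      using ineq[OF \<open>t \<in> {a..b}\<close>] by simp
    then have "0 \<le> (\<psi>' t - L * \<psi> t) * exp (- L * t)"
      by simp
    ultimately show "\<exists>y. ((\<lambda>t. \<psi> t * exp (- L * t)) has_real_derivative y) (at t) \<and> 0 \<le> y"
      by blast
  qed
  moreover have "0 \<le> \<psi> t0 * exp (- L * t0)"
    using t0 by simp
  moreover have "\<psi> s' * exp (- L * s') < 0"
    using small[of s'] s' by (simp add: mult_neg_pos)
  ultimately show False
    by linarith
qed

text \<open>Multiplying the inequality by \<open>y powr (- q)\<close> separates the variables: the
  left side becomes the derivative of \<open>y powr (1 - q) / (1 - q)\<close>, the right side
  \<open>- c\<close>. The sign of \<open>c\<close> is irrelevant.\<close>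

lemma powr_comparison:
  fixes y :: "real \<Rightarrow> real"
  assumes T: "0 \<le> T" and q: "q < 1"
    and c: "continuous_on {0..T} c"
    and pos: "\<And>t. t \<in> {0..T} \<Longrightarrow> 0 < y t"
    and deriv: "\<And>t. t \<in> {0..T} \<Longrightarrow> (y has_real_derivative y' t) (at t within {0..T})"
    and ineq: "\<And>t. t \<in> {0..T} \<Longrightarrow> y' t \<le> - c t * y t powr q"
  shows "y T powr (1 - q) / (1 - q) + integral {0..T} c \<le> y 0 powr (1 - q) / (1 - q)"
proof -
  let ?V = "\<lambda>t. y t powr (1 - q) / (1 - q) + integral {0..t} c"
  have dV: "(?V has_real_derivative y t powr (- q) * y' t + c t) (at t within {0..T})"
    if t: "t \<in> {0..T}" for t
  proof -
    have "((\<lambda>t. y t powr (1 - q)) has_real_derivative (1 - q) * y t powr (1 - q - 1) * y' t)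
        (at t within {0..T})"
      by (rule DERIV_chain2[OF has_real_derivative_powr[OF pos[OF t]] deriv[OF t]])
    from DERIV_add[OF DERIV_cdivide[OF this, of "1 - q"] integral_has_real_derivative[OF c t]]
    show ?thesis
      using q by simp
  qed
  have "?V T \<le> ?V 0"
  proof (rule DERIV_nonpos_imp_decreasing_open[OF T])
    show "continuous_on {0..T} ?V"
      using dV DERIV_continuous unfolding continuous_on_eq_continuous_within by blast
    fix t assume t: "0 < t" "t < T"
    then have mem: "t \<in> {0..T}"
      by simp
    have "y t powr (- q) * y' t \<le> y t powr (- q) * (- c t * y t powr q)"
      by (intro mult_left_mono ineq[OF mem]) auto
    also have "\<dots> = - c t * (y t powr (- q) * y t powr q)"
      by simp
    also have "y t powr (- q) * y t powr q = 1"
      using pos[OF mem] by (simp add: powr_minus)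
    finally show "\<exists>d. (?V has_real_derivative d) (at t) \<and> d \<le> 0"
      using dV[OF mem] t by (intro exI[of _ "y t powr (- q) * y' t + c t"]) (simp add: at_within_Icc_at)
  qed
  then show ?thesis
    by simp
qed

theorem theorem4:
  fixes f :: "real^'n \<Rightarrow> real^'n" and g :: "real^'n \<Rightarrow> real^'p^'n"
    and u_min u_max :: "real^'p" and U :: "(real^'p) set"
    and h :: "real^'n \<Rightarrow> real" and q :: real and \<beta> c :: "real \<Rightarrow> real"
    and m :: nat and F G :: "nat \<Rightarrow> fvec \<Rightarrow> fvec" and a :: "nat \<Rightarrow> fvec \<Rightarrow> real"
    and \<sigma> :: "nat \<Rightarrow> nat \<Rightarrow> ereal" and \<gamma> :: "nat \<Rightarrow> nat \<Rightarrow> real \<Rightarrow> real" and \<epsilon> :: real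
    and \<rho> :: "nat \<Rightarrow> ereal" and \<alpha> :: "nat \<Rightarrow> real \<Rightarrow> real"
    and x :: "real \<Rightarrow> real^'n" and \<pi> :: "real \<Rightarrow> auxstate"
    and u :: "real \<Rightarrow> real^'p" and \<nu> :: "real \<Rightarrow> fvec" and T :: real
  assumes m: "2 \<le> m"
    and U: "U = {v. \<forall>k. u_min $ k \<le> v $ k \<and> v $ k \<le> u_max $ k}"
    and f: "locally_lipschitz UNIV f" and g: "locally_lipschitz UNIV g"
    and F: "\<And>i. i \<in> {1..m - 1} \<Longrightarrow>
              F i ` rvec (m - i) \<subseteq> rvec (m - i) \<and> locally_lipschitz (rvec (m - i)) (F i)"
    and G: "\<And>i. i \<in> {1..m - 1} \<Longrightarrow>
              G i ` rvec (m - i) \<subseteq> rvec (m - i) \<and> locally_lipschitz (rvec (m - i)) (G i)"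
    and \<epsilon>: "0 < \<epsilon>"
    and q: "0 < q" "q < 1"
    and \<beta>: "extended_class_kappa \<beta>" "\<And>s. 0 \<le> s \<Longrightarrow> \<beta> s = s powr q"
    and c: "continuous_on {0..} c"
    and avclbf: "AVCLBF f g U h \<beta> c m F G a \<sigma> \<gamma> \<epsilon> \<rho> \<alpha>"
    \<comment> \<open>closed-loop trajectory, under a controller with admissible values\<close>
    and x_ode: "\<And>t. 0 \<le> t \<Longrightarrow> (x has_vector_derivative f (x t) + g (x t) *v u t) (at t within {0..})"
    and aux_state: "\<And>t. 0 \<le> t \<Longrightarrow> \<pi> t \<in> aux_space m"
    and aux_ode: "\<And>t. 0 \<le> t \<Longrightarrow>
              (\<pi> has_vector_derivative aux_field m F G (\<pi> t) (\<nu> t)) (at t within {0..})"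
    and u: "\<And>t. 0 \<le> t \<Longrightarrow> u t \<in> U"
    and \<nu>: "\<And>t. 0 \<le> t \<Longrightarrow> \<nu> t \<in> aux_inputs m F G a \<gamma> \<epsilon> (\<pi> t)"
    and a_pos: "\<And>t i. 0 \<le> t \<Longrightarrow> i \<in> {1..m - 1} \<Longrightarrow> 0 < a i (Poly_Mapping.lookup (\<pi> t) i)"
    and psi_defined: "\<And>t. 0 \<le> t \<Longrightarrow> h (x t) \<noteq> 0 \<Longrightarrow>
              (x t, \<pi> t, t) \<in> psi_dom f g h \<beta> c m F G a \<rho> \<alpha>"
    and h0: "0 < h (x 0)"
    and B0: "\<And>i. i \<le> m - 2 \<Longrightarrow> (x 0, \<pi> 0) \<in> B_set f g h \<beta> c m F G a \<alpha> i 0"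
    and constraint: "\<And>t. 0 \<le> t \<Longrightarrow> h (x t) \<noteq> 0 \<Longrightarrow>
              0 \<le> psi f g h \<beta> c m F G a \<alpha> (m - 1) (x t, \<pi> t, t) (u t, \<nu> t)"
    and C_invertible: "inj_on (c_int c) {0..}"
    and C_range: "c_int c 0 + h (x 0) powr (1 - q) / (1 - q) \<in> c_int c ` {0..}"
    and T: "T = the_inv_into {0..} (c_int c) (c_int c 0 + h (x 0) powr (1 - q) / (1 - q))"
  shows "\<exists>t\<^sub>r\<in>{0..T}. h (x t\<^sub>r) = 0"
proof (rule ccontr)
  assume "\<not> ?thesis"
  then have nz: "h (x t) \<noteq> 0" if "t \<in> {0..T}" for t
    using that by blast
  have "T \<in> {0..}"
    unfolding T using C_invertible C_range by (rule the_inv_into_into) simp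
  then have T0: "0 \<le> T"
    by simp
  \<comment> \<open>\<open>c_int c 0\<close> vanishes, being an integral over a single
    point.\<close>
  have CT: "c_int c T = h (x 0) powr (1 - q) / (1 - q)"
    unfolding T using f_the_inv_into_f[OF C_invertible C_range] by (simp add: c_int_def)

  let ?psi = "psi f g h \<beta> c m F G a \<alpha>"
  \<comment> \<open>Time is carried as a state component of rate 1, so the explicit time dependence
    of \<open>c\<close> is covered by the chain rule along \<open>z\<close>.\<close>
  define z where "z t = (x t, \<pi> t, t)" for t
  define w where "w t = (u t, \<nu> t)" for t
  let ?I = "{0..T}"
  have z_tspace: "z t \<in> tspace m" if "t \<in> ?I" for t
    using that aux_state by (auto simp: z_def tspace_def)
  have z_psi_dom: "z t \<in> psi_dom f g h \<beta> c m F G a \<rho> \<alpha>" if "t \<in> ?I" for t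
    using that psi_defined nz by (auto simp: z_def)
  have \<nu>_rvec: "\<nu> t \<in> rvec (m - 1)" if "t \<in> ?I" for t
    using that \<nu>[of t] by (auto simp: aux_inputs_def)
  \<comment> \<open>The recursion for \<open>psi\<close> differentiates the function at zero input,
    whereas the constraint concerns the actual input; below level \<open>m - 1\<close> the two
    values agree.\<close>
  have input_free: "?psi i (z t) (w t) = ?psi i (z t) (0, 0)" if "t \<in> ?I" "i < m - 1" for t i
    using avclbf z_psi_dom[OF that(1)] \<nu>_rvec[OF that(1)] that(2) unfolding AVCLBF_def w_def by blast
  have field_tspace: "full_dyn f g m F G (z t) (w t) \<in> tspace m" if "t \<in> ?I" for t
  proof -
    have "F i ` rvec (m - i) \<subseteq> rvec (m - i)" "G i ` rvec (m - i) \<subseteq> rvec (m - i)"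
      if "i \<in> {1..m - 1}" for i
      using F[OF that] G[OF that] by blast+
    then have "aux_field m F G (\<pi> t) (\<nu> t) \<in> aux_space m"
      by (intro aux_field_in_aux_space aux_state) (use that in auto)
    then show ?thesis
      by (simp add: z_def w_def tspace_def)
  qed
  have x_deriv: "(x has_vector_derivative ctrl_dyn f g (x t) (u t)) (at t within ?I)" if "t \<in> ?I" for t
    unfolding ctrl_dyn_def using x_ode[of t] that by (auto intro: has_vector_derivative_within_subset)
  have z_deriv: "(z has_vector_derivative full_dyn f g m F G (z t) (w t)) (at t within ?I)"
    if "t \<in> ?I" for t
  proof -
    have "(\<pi> has_vector_derivative aux_field m F G (\<pi> t) (\<nu> t)) (at t within ?I)"
      using aux_ode[of t] that by (auto intro: has_vector_derivative_within_subset)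
    then show ?thesis
      unfolding z_def w_def full_dyn.simps
      by (intro has_vector_derivative_Pair x_deriv[OF that] has_vector_derivative_id)
  qed
  have psi_deriv: "((\<lambda>t. ?psi i (z t) (0, 0)) has_real_derivative
      lie (\<lambda>z'. ?psi i z' (0, 0)) (z t) (full_dyn f g m F G (z t) (w t))) (at t within ?I)"
    if "t \<in> ?I" "i < m - 1" for t i
  proof (rule has_real_derivative_lie[where \<phi> = "\<lambda>z'. ?psi i z' (0, 0)", OF subspace_tspace])
    show "(\<lambda>z'. ?psi i z' (0, 0)) differentiable (at (z t) within tspace m)"
      using avclbf z_psi_dom[OF that(1)] that(2) unfolding AVCLBF_def by blast
  qed (use that z_deriv z_tspace field_tspace in auto)

  have descend: "\<forall>t\<in>?I. 0 \<le> ?psi i (z t) (w t)" if "i \<le> m - 1" for i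
    using that
  proof (induction i rule: inc_induct)
    case base
    show ?case
      using constraint nz by (auto simp: z_def w_def)
  next
    case (step i)
    then have i: "i < m - 1"
      by simp
    have "admissible_extension (\<alpha> (Suc i))"
      using avclbf i unfolding AVCLBF_def by auto
    moreover have "0 \<le> ?psi i (z 0) (0, 0)"
      using B0[of i] i by (auto simp: B_set_def z_def)
    moreover have "0 \<le> lie (\<lambda>z'. ?psi i z' (0, 0)) (z t) (full_dyn f g m F G (z t) (w t))
        + \<alpha> (Suc i) (?psi i (z t) (0, 0))" if t: "t \<in> ?I" for t
    proof -
      \<comment> \<open>The factor in \<open>psi\<close> at level \<open>i + 1\<close> has index
        \<open>i + 2\<close>, which is at most \<open>m - 1\<close> exactly when
        \<open>Suc i < m - 1\<close>; the top level has factor 1. Either way it is positive and can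
        be cancelled.\<close>
      let ?A = "if Suc i < m - 1
          then a (i + 2) (Poly_Mapping.lookup (fst (snd (z t))) (i + 2)) else 1"
      have "0 < ?A"
        using t a_pos[of t "i + 2"] i by (auto simp: z_def)
      moreover have "0 \<le> ?A * (lie (\<lambda>z'. ?psi i z' (0, 0)) (z t) (full_dyn f g m F G (z t) (w t))
          + \<alpha> (Suc i) (?psi i (z t) (0, 0)))"
        using step.IH t unfolding psi.simps by blast
      ultimately show ?thesis
        by (metis mult_pos_neg not_le)
    qed
    ultimately have "0 \<le> ?psi i (z t) (0, 0)" if "t \<in> ?I" for t
      using nonneg_of_deriv_plus_kappa_nonneg[where \<psi> = "\<lambda>t. ?psi i (z t) (0, 0)",
          OF _ _ psi_deriv[OF _ i]] that by blast
    then show ?case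
      using input_free[OF _ i] by simp
  qed

  \<comment> \<open>\<open>drift_deriv\<close> of order 0 is \<open>h\<close> itself.\<close>
  have h_diff: "h differentiable (at (x t) within UNIV)" for t
    using avclbf by (auto simp: AVCLBF_def relative_degree_def differentiable_on_def dest: spec[of _ 0])
  have h_deriv: "((\<lambda>t. h (x t)) has_real_derivative lie h (x t) (ctrl_dyn f g (x t) (u t)))
      (at t within ?I)" if "t \<in> ?I" for t
    using has_real_derivative_lie[OF subspace_UNIV h_diff x_deriv[OF that]] by simp
  have h_cont: "continuous_on ?I (\<lambda>t. h (x t))"
    using h_deriv DERIV_continuous unfolding continuous_on_eq_continuous_within by blast
  \<comment> \<open>A continuous function that starts positive and has no zero stays
    positive.\<close>
  have h_pos: "0 < h (x t)" if t: "t \<in> ?I" for t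
  proof (rule ccontr)
    assume "\<not> 0 < h (x t)"
    then have "\<exists>r\<ge>0. r \<le> t \<and> h (x r) = 0"
      using t h0 by (intro IVT2' continuous_on_subset[OF h_cont]) auto
    then show False
      using nz t by auto
  qed
  \<comment> \<open>This is \<open>psi\<close> at level 0 with the positive factor
    \<open>a 1\<close> cancelled; \<open>h_pos\<close> allows \<beta> to be read as the power
    \<open>q\<close>.\<close>
  have "lie h (x t) (ctrl_dyn f g (x t) (u t)) \<le> - c t * h (x t) powr q" if t: "t \<in> ?I" for t
  proof -
    have "0 \<le> a 1 (Poly_Mapping.lookup (\<pi> t) 1) *
        (- lie h (x t) (ctrl_dyn f g (x t) (u t)) - c t * \<beta> (h (x t)))"
      using descend[of 0] t by (simp add: z_def w_def)
    moreover have "0 < a 1 (Poly_Mapping.lookup (\<pi> t) 1)"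
      using t m by (intro a_pos) auto
    ultimately show ?thesis
      using h_pos[OF t] \<beta>(2)[of "h (x t)"] by (simp add: zero_le_mult_iff)
  qed
  \<comment> \<open>By \<open>CT\<close> the integral equals the right-hand side, which forces the
    first summand to be at most 0, contrary to \<open>h_pos\<close>.\<close>
  then have "h (x T) powr (1 - q) / (1 - q) + c_int c T \<le> h (x 0) powr (1 - q) / (1 - q)"
    unfolding c_int_def using T0 q h_pos h_deriv
    by (intro powr_comparison[where y = "\<lambda>t. h (x t)"] continuous_on_subset[OF c]) auto
  moreover have "0 < h (x T) powr (1 - q) / (1 - q)"
    using h_pos[of T] T0 q by simp
  ultimately show False
    using CT by simp
qed

end
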